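(* Assume that $\phi_f$ is integrable and that $\mathrm{E}[X^2]<\infty$. Assume that $\phi_w$ is bounded, real valued, symmetric, vanishes outside $[-1,1]$, satisfies $\phi_w(0)=1$, and that $$\phi_w(1-t)=At^\alpha+o(t^\alpha)\quad\text{as } t\downarrow0$$ for some constants $A$ and $\alpha\ge0$. Let $$f_{nh}(x)=\frac1{2\pi}\int_{-\infty}^\infty e^{-itx}\,\frac{\phi_{emp}(t)-p\,e^{-\sigma^2t^2/2}}{(1-p)\,e^{-\sigma^2t^2/2}}\,\phi_w(ht)\,dt .$$ Then, for every fixed $x\in\mathbb{R}$, as $n\to\infty$ and $h=h_n\to0$ ($h_n>0$), $$\frac{\sqrt n}{h^{1+2\alpha}e^{\sigma^2/(2h^2)}}\bigl(f_{nh}(x)-\mathrm{E}[f_{nh}(x)]\bigr)\xrightarrow{\mathcal D}N\!\left(0,\ \frac{A^2}{2\pi^2(1-p)^2}\left(\frac1{\sigma^2}\right)^{2+2\alpha}(\Gamma(\alpha+1))^2\right),$$ where $\Gamma(t)=\int_0^\infty v^{t-1}e^{-v}\,dv$ and $\xrightarrow{\mathcal D}$ denotes convergence in distribution.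
   Context: Setting: $\sigma>0$ and $0\le p<1$ are known. $U,V,Z$ are independent random variables, $U$ is Bernoulli with $P(U=0)=p$ and $P(U=1)=1-p$, $V$ has a density $f$ on $\mathbb{R}$ with characteristic function $\phi_f(t)=\int e^{itx}f(x)\,dx$, and $Z$ is standard normal. Put $Y=UV$ and $X=Y+\sigma Z$. $X_1,X_2,\dots$ are i.i.d. copies of $X$, and $\phi_{emp}(t)=\frac1n\sum_{j=1}^n e^{itX_j}$. $\phi_w$ is the Fourier transform of a kernel function $w$, in the convention $w(x)=\frac1{2\pi}\int_{-\infty}^\infty e^{-itx}\phi_w(t)\,dt$. *)

theory Defs
  imports "HOL-Probability.Probability" "HOL-Library.Landau_Symbols"
begin

definition fourier_transform :: "(real \<Rightarrow> real) \<Rightarrow> real \<Rightarrow> complex" where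
  "fourier_transform f t = (CLBINT x. iexp (t * x) * complex_of_real (f x))"

definition inverse_fourier_transform :: "(real \<Rightarrow> complex) \<Rightarrow> real \<Rightarrow> complex" where
  "inverse_fourier_transform \<phi> x =
     complex_of_real (1 / (2 * pi)) * (CLBINT t. iexp (- (t * x)) * \<phi> t)"

text \<open>The sample points are numbered from \<open>0\<close>, so a sample of size \<open>n\<close> is \<open>Xs 0, \<dots>, Xs (n - 1)\<close>.\<close>

definition emp_char :: "(nat \<Rightarrow> 'a \<Rightarrow> real) \<Rightarrow> nat \<Rightarrow> 'a \<Rightarrow> real \<Rightarrow> complex" where
  "emp_char Xs n \<omega> t = complex_of_real (1 / real n) * (\<Sum>j<n. iexp (t * Xs j \<omega>))"

definition deconv_integral ::
  "real \<Rightarrow> real \<Rightarrow> (real \<Rightarrow> real) \<Rightarrow> (real \<Rightarrow> complex) \<Rightarrow> real \<Rightarrow> real \<Rightarrow> complex" where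
  "deconv_integral \<sigma> p \<phi>w \<phi>emp h =
     inverse_fourier_transform
       (\<lambda>t. (\<phi>emp t - complex_of_real (p * exp (- (\<sigma>\<^sup>2 * t\<^sup>2 / 2)))) /
            complex_of_real ((1 - p) * exp (- (\<sigma>\<^sup>2 * t\<^sup>2 / 2))) *
            complex_of_real (\<phi>w (h * t)))"

text \<open>The integral defining the estimator is complex, but its value is real when \<open>\<phi>w\<close> is symmetric
  (see \<open>complex_of_real_deconv_estimator\<close> below), so taking the real part loses nothing.\<close>

definition deconv_estimator ::
  "real \<Rightarrow> real \<Rightarrow> (real \<Rightarrow> real) \<Rightarrow> (nat \<Rightarrow> 'a \<Rightarrow> real) \<Rightarrow> nat \<Rightarrow> real \<Rightarrow> real \<Rightarrow> 'a \<Rightarrow> real" where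
  "deconv_estimator \<sigma> p \<phi>w Xs n h x \<omega> = Re (deconv_integral \<sigma> p \<phi>w (emp_char Xs n \<omega>) h x)"

lemma cnj_emp_char: "cnj (emp_char Xs n \<omega> t) = emp_char Xs n \<omega> (- t)"
  by (simp add: emp_char_def exp_cnj)

lemma cnj_deconv_integral:
  assumes sym: "\<And>t. \<phi>w (- t) = \<phi>w t"
  shows "cnj (deconv_integral \<sigma> p \<phi>w (emp_char Xs n \<omega>) h x) =
         deconv_integral \<sigma> p \<phi>w (emp_char Xs n \<omega>) h x"
proof -
  define g where "g t = iexp (- (t * x)) *
    ((emp_char Xs n \<omega> t - complex_of_real (p * exp (- (\<sigma>\<^sup>2 * t\<^sup>2 / 2)))) /
     complex_of_real ((1 - p) * exp (- (\<sigma>\<^sup>2 * t\<^sup>2 / 2))) * complex_of_real (\<phi>w (h * t)))" for t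
  have g: "cnj (g t) = g (- t)" for t
    using sym[of "h * t"] by (simp add: g_def exp_cnj cnj_emp_char)
  have "cnj (CLBINT t. g t) = (CLBINT t. g (- t))"
    unfolding g[symmetric] by (rule Bochner_Integration.integral_cnj[symmetric])
  also have "\<dots> = (CLBINT t. g t)"
    using lborel_integral_real_affine[of "-1" g 0] by simp
  finally show ?thesis
    by (simp add: deconv_integral_def inverse_fourier_transform_def g_def)
qed

lemma complex_of_real_deconv_estimator:
  assumes "\<And>t. \<phi>w (- t) = \<phi>w t"
  shows "complex_of_real (deconv_estimator \<sigma> p \<phi>w Xs n h x \<omega>) =
         deconv_integral \<sigma> p \<phi>w (emp_char Xs n \<omega>) h x"
  using cnj_deconv_integral[of \<phi>w \<sigma> p Xs n \<omega> h x] assms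
  by (simp add: deconv_estimator_def complex_eq_iff)

text \<open>Normal law with mean \<open>\<mu>\<close> and variance \<open>v\<close>.  The value \<open>v = 0\<close> is meaningful (a point mass);
  it is needed because \<open>normal_density \<mu> 0\<close> is the zero function, not a probability density.\<close>

definition normal_distribution :: "real \<Rightarrow> real \<Rightarrow> real measure" where
  "normal_distribution \<mu> v =
     (if v = 0 then return borel \<mu> else density lborel (normal_density \<mu> (sqrt v)))"

end

theory Submission
  imports Defs
begin

text \<open>
  After centring, the estimator is \<open>1/n\<close> times a sum of i.i.d. variables \<open>K (X\<^sub>j - x) - E K (X\<^sub>j - x)\<close>, where
  \<open>K u = 1 / (\<pi> (1 - p)) * \<integral> cos (t u) exp (\<sigma>\<^sup>2 t\<^sup>2 / 2) \<phi>w (h t) dt\<close>, integrated over \<open>0 < t < 1/h\<close>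
  (lemmas \<open>deconv_estimator_eq_average\<close> and \<open>deconv_kernel_eq_edge_integral\<close>).

  The weight \<open>exp (\<sigma>\<^sup>2 t\<^sup>2 / 2)\<close> grows so fast that only frequencies within distance \<open>O(h)\<close> of the cut-off \<open>1/h\<close>
  matter.  There the phase \<open>t u\<close> is nearly constant, equal to \<open>u/h\<close>, and
  \<open>\<phi>w (1 - h\<^sup>2 v)\<close> behaves like \<open>A (h\<^sup>2 v) powr \<alpha>\<close>; a Laplace-type argument
  turns the integral into a Gamma integral.  Hence, divided by \<open>h powr (1 + 2 \<alpha>) * exp (\<sigma>\<^sup>2 / (2 h\<^sup>2))\<close>, the
  kernel is uniformly bounded and asymptotically the pure oscillation \<open>C cos (u/h) / (\<pi> (1 - p))\<close> with
  \<open>C = A \<Gamma>(\<alpha> + 1) / \<sigma> powr (2 \<alpha> + 2)\<close> (lemmas \<open>edge_integral_bounded\<close> and \<open>edge_integral_asymptotics\<close>).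

  Since the noise is Gaussian, the characteristic function of \<open>X\<close> vanishes at infinity.  So
  \<open>(X - x)/h\<close> is asymptotically uniform modulo \<open>2\<pi>\<close>, and the variance of the oscillation tends to \<open>C\<^sup>2/2\<close>
  (lemma \<open>variance_of_oscillation\<close>).  Each summand is bounded uniformly in \<open>n\<close> while the total variance
  is of order \<open>n\<close>, or smaller if \<open>A = 0\<close>, so a central limit theorem for triangular arrays with bounded rows
  (lemma \<open>triangular_clt_bounded\<close>) gives the limit law, with variance \<open>C\<^sup>2 / (2 \<pi>\<^sup>2 (1 - p)\<^sup>2)\<close>.
  The bound on the summands does not involve \<open>h\<close>, so \<open>n\<close> and \<open>1/h\<close> may grow at unrelated rates.
\<close>

section \<open>A central limit theorem for bounded triangular arrays\<close>

lemma exp_minus_approx: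
  fixes y :: real
  assumes "0 \<le> y"
  shows "\<bar>exp (- y) - (1 - y)\<bar> \<le> y\<^sup>2"
proof -
  have "exp (- y) \<le> 1 / (1 + y)"
    using exp_ge_add_one_self[of y] assms by (simp add: exp_minus field_simps)
  also have "\<dots> \<le> 1 - y + y\<^sup>2"
    using assms by (simp add: field_simps power2_eq_square)
  finally show ?thesis
    using exp_ge_add_one_self[of "- y"] by simp
qed

text \<open>Scaling a standard normal variable by \<open>sqrt v\<close> covers the point mass \<open>v = 0\<close> together with the
  nondegenerate laws, so that the characteristic function below needs no case distinction.\<close>

lemma normal_distribution_eq_distr:
  assumes "0 \<le> v"
  shows "normal_distribution 0 v = distr std_normal_distribution borel (\<lambda>z. sqrt v * z)"
proof (cases "v = 0")
  case True
  have "distr std_normal_distribution borel (\<lambda>_. 0) = return borel (0::real)"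
    using prob_space.distr_const[OF prob_space_normal_density, of 1 0 borel 0] by simp
  then show ?thesis using True by (simp add: normal_distribution_def)
next
  case False
  then have v: "0 < sqrt v" using assms by simp
  interpret N: prob_space std_normal_distribution
    by (rule prob_space_normal_density) simp
  have "distributed std_normal_distribution lborel (\<lambda>z. z) std_normal_density"
    by (simp add: distributed_def distr_id2)
  from N.normal_density_affine[OF this, of "sqrt v" 0] v
  have "distr std_normal_distribution lborel (\<lambda>z. sqrt v * z) = density lborel (normal_density 0 (sqrt v))"
    by (simp add: distributed_def)
  moreover have "distr std_normal_distribution lborel (\<lambda>z. sqrt v * z) = distr std_normal_distribution borel (\<lambda>z. sqrt v * z)"
    by (rule distr_cong) auto
  ultimately show ?thesis using False by (simp add: normal_distribution_def)
qed

lemma real_distribution_normal_distribution: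
  assumes "0 \<le> v"
  shows "real_distribution (normal_distribution 0 v)"
  unfolding normal_distribution_eq_distr[OF assms]
  by (rule prob_space.real_distribution_distr[OF prob_space_normal_density]) auto

lemma char_normal_distribution:
  assumes "0 \<le> v"
  shows "char (normal_distribution 0 v) t = exp (- (v * t\<^sup>2 / 2))"
proof -
  have "char (normal_distribution 0 v) t = char std_normal_distribution (t * sqrt v)"
    unfolding normal_distribution_eq_distr[OF assms] char_def
    by (subst integral_distr) (auto simp: mult.assoc)
  then show ?thesis
    using assms by (simp add: char_std_normal_distribution power_mult_distrib mult.commute)
qed

text \<open>A central limit theorem for arrays whose \<open>n\<close>-th row is \<open>g n\<close> applied to one fixed i.i.d.
  sequence.  Uniform boundedness of the \<open>g n\<close> controls the third moments, so the second-order
  expansion of the characteristic function of one summand has error \<open>O(n powr (- 3/2))\<close> uniformly in the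
  row.  Comparing with \<open>exp (- y)\<close> for \<open>y = t\<^sup>2 V / (2 n)\<close>, where \<open>V\<close> is the variance in row \<open>n\<close>, instead of \<open>1 - y\<close> has two advantages:
  both bases have modulus at most \<open>1\<close> for every \<open>n\<close>, so taking the \<open>n\<close>-th power multiplies the error by at
  most \<open>n\<close>, and the power is exactly the characteristic function of a normal law with variance \<open>V\<close>.  The
  limiting variance may be \<open>0\<close>.\<close>

lemma (in prob_space) triangular_clt_bounded:
  fixes Xs :: "nat \<Rightarrow> 'a \<Rightarrow> real" and g :: "nat \<Rightarrow> real \<Rightarrow> real"
  assumes indep: "indep_vars (\<lambda>_. borel) Xs UNIV"
    and distr: "\<And>j. distr M borel (Xs j) = \<mu>"
    and g[measurable]: "\<And>n. g n \<in> borel_measurable borel"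
    and bound: "\<And>n y. \<bar>g n y\<bar> \<le> B"
    and mean: "\<And>n. (LINT y|\<mu>. g n y) = 0"
    and var: "(\<lambda>n. LINT y|\<mu>. (g n y)\<^sup>2) \<longlonglongrightarrow> v"
  shows "weak_conv_m (\<lambda>n. distr M borel (\<lambda>\<omega>. (\<Sum>j<n. g n (Xs j \<omega>)) / sqrt (real n)))
    (normal_distribution 0 v)"
proof (rule levy_continuity)
  have [measurable]: "Xs j \<in> borel_measurable M" for j
    using indep by (simp add: indep_vars_def2)
  interpret \<mu>: real_distribution \<mu>
    by (subst distr[symmetric, of 0]) simp
  have B: "0 \<le> B" using bound[of 0 0] by simp
  define V where "V n = (LINT y|\<mu>. (g n y)\<^sup>2)" for n
  have V0: "0 \<le> V n" for n by (simp add: V_def)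
  have v: "0 \<le> v"
    using LIMSEQ_le_const[OF var, of 0] V0 by (auto simp: V_def)
  have gi: "integrable \<mu> (g n)" for n
    by (rule \<mu>.integrable_const_bound[of _ B]) (auto simp: bound)
  have bp: "\<bar>g n y\<bar> ^ k \<le> B ^ k" for n y k
    by (rule power_mono) (auto simp: bound)
  have gi2: "integrable \<mu> (\<lambda>y. (g n y)\<^sup>2)" for n
    by (rule \<mu>.integrable_const_bound[of _ "B\<^sup>2"]) (use bp[of _ _ 2] in auto)
  have VB: "V n \<le> B\<^sup>2" for n
    unfolding V_def by (rule \<mu>.integral_le_const[OF gi2]) (use bp[of _ _ 2] in auto)
  show "real_distribution (normal_distribution 0 v)"
    using v by (rule real_distribution_normal_distribution)
  show "real_distribution (distr M borel (\<lambda>\<omega>. (\<Sum>j<n. g n (Xs j \<omega>)) / sqrt (real n)))" for n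
    by (rule real_distribution_distr) simp
  fix t :: real
  define \<phi> where "\<phi> n = char (distr M borel (\<lambda>\<omega>. (\<Sum>j<n. g n (Xs j \<omega>)) / sqrt (real n))) t" for n
  have main: "norm (\<phi> n - exp (- (V n * t\<^sup>2 / 2)))
      \<le> \<bar>t\<bar> ^ 3 * B ^ 3 / 6 * (1 / sqrt (real n)) + t ^ 4 * B ^ 4 / 4 * (1 / real n)"
    if n: "0 < n" for n
  proof -
    define s where "s = t / sqrt (real n)"
    define \<psi> where "\<psi> = char (distr \<mu> borel (g n)) s"
    define y where "y = s\<^sup>2 * V n / 2"
    have y0: "0 \<le> y" by (simp add: y_def V0)
    have y_le: "y \<le> s\<^sup>2 * B\<^sup>2 / 2"
      unfolding y_def using VB[of n] by (simp add: mult_left_mono)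
    have "\<phi> n = char (distr M borel (\<lambda>\<omega>. \<Sum>j<n. g n (Xs j \<omega>) / sqrt (real n))) t"
      by (simp add: \<phi>_def sum_divide_distrib)
    also have "\<dots> = (\<Prod>j<n. char (distr M borel (\<lambda>\<omega>. g n (Xs j \<omega>) / sqrt (real n))) t)"
      by (rule char_distr_sum, rule indep_vars_compose2[where X=Xs],
          rule indep_vars_subset[OF indep]) auto
    also have "\<dots> = (\<Prod>j<n. \<psi>)"
    proof (rule prod.cong[OF refl])
      show "char (distr M borel (\<lambda>\<omega>. g n (Xs j \<omega>) / sqrt (real n))) t = \<psi>" for j
        unfolding \<psi>_def distr[symmetric, of j]
        by (simp add: char_def integral_distr s_def)
    qed
    finally have \<phi>: "\<phi> n = \<psi> ^ n" by simp
    interpret D: real_distribution "distr \<mu> borel (g n)" by simp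
    have "cmod (\<psi> - (1 - s\<^sup>2 * V n / 2)) \<le>
        s\<^sup>2 / 6 * (LINT y|\<mu>. min (6 * (g n y)\<^sup>2) (\<bar>s\<bar> * \<bar>g n y\<bar> ^ 3))"
      unfolding \<psi>_def
      by (rule \<mu>.char_approx3'[where X = "g n"]) (use gi gi2 mean in \<open>auto simp: V_def\<close>)
    also have "(LINT y|\<mu>. min (6 * (g n y)\<^sup>2) (\<bar>s\<bar> * \<bar>g n y\<bar> ^ 3)) \<le> \<bar>s\<bar> * B ^ 3"
    proof (rule \<mu>.integral_le_const)
      show "integrable \<mu> (\<lambda>y. min (6 * (g n y)\<^sup>2) (\<bar>s\<bar> * \<bar>g n y\<bar> ^ 3))"
        by (rule Bochner_Integration.integrable_bound[OF integrable_mult_right[OF gi2[of n], of 6]]) auto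
      show "AE y in \<mu>. min (6 * (g n y)\<^sup>2) (\<bar>s\<bar> * \<bar>g n y\<bar> ^ 3) \<le> \<bar>s\<bar> * B ^ 3"
        using bp[of n _ 3] by (auto simp: min_le_iff_disj mult_left_mono)
    qed
    finally have 1: "cmod (\<psi> - (1 - y)) \<le> s\<^sup>2 / 6 * (\<bar>s\<bar> * B ^ 3)"
      by (simp add: y_def mult_left_mono)
    have "cmod (of_real (exp (- y)) - (1 - of_real y)) = \<bar>exp (- y) - (1 - y)\<bar>"
      by (metis norm_of_real of_real_1 of_real_diff)
    also have "\<dots> \<le> y\<^sup>2" by (rule exp_minus_approx[OF y0])
    also have "\<dots> \<le> (s\<^sup>2 * B\<^sup>2 / 2)\<^sup>2" by (rule power_mono[OF y_le y0])
    finally have 2: "cmod (of_real (exp (- y)) - (1 - of_real y)) \<le> (s\<^sup>2 * B\<^sup>2 / 2)\<^sup>2" .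
    have 3: "cmod (\<psi> - of_real (exp (- y))) \<le> s\<^sup>2 / 6 * (\<bar>s\<bar> * B ^ 3) + (s\<^sup>2 * B\<^sup>2 / 2)\<^sup>2"
      using norm_triangle_ineq4[of "\<psi> - (1 - y)" "of_real (exp (- y)) - (1 - of_real y)"] 1 2
      by simp
    have "of_real (exp (- y)) ^ n = complex_of_real (exp (- (real n * y)))"
      by (simp flip: of_real_power exp_of_nat_mult)
    also have "real n * y = V n * t\<^sup>2 / 2"
      using n by (simp add: y_def s_def power_divide)
    finally have "norm (\<phi> n - exp (- (V n * t\<^sup>2 / 2))) = norm (\<psi> ^ n - of_real (exp (- y)) ^ n)"
      by (simp add: \<phi>)
    also have "\<dots> \<le> n * cmod (\<psi> - of_real (exp (- y)))"
      by (rule norm_power_diff) (use y0 D.cmod_char_le_1 in \<open>auto simp: \<psi>_def\<close>)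
    also have "\<dots> \<le> n * (s\<^sup>2 / 6 * (\<bar>s\<bar> * B ^ 3) + (s\<^sup>2 * B\<^sup>2 / 2)\<^sup>2)"
      by (rule mult_left_mono[OF 3]) simp
    also have "\<dots> = (n * s\<^sup>2) * \<bar>s\<bar> * B ^ 3 / 6 + (n * s\<^sup>2) * s\<^sup>2 * B ^ 4 / 4"
      by (simp add: field_simps power2_eq_square power4_eq_xxxx)
    also have "n * s\<^sup>2 = t\<^sup>2" using n by (simp add: s_def power_divide)
    also have "\<bar>s\<bar> = \<bar>t\<bar> * (1 / sqrt (real n))" by (simp add: s_def)
    also have "s\<^sup>2 = t\<^sup>2 * (1 / real n)" by (simp add: s_def power_divide)
    also have "t\<^sup>2 * (\<bar>t\<bar> * (1 / sqrt (real n))) * B ^ 3 / 6 + t\<^sup>2 * (t\<^sup>2 * (1 / real n)) * B ^ 4 / 4 =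
        \<bar>t\<bar> ^ 3 * B ^ 3 / 6 * (1 / sqrt (real n)) + t ^ 4 * B ^ 4 / 4 * (1 / real n)"
      by (simp add: power3_eq_cube power2_eq_square power4_eq_xxxx)
    finally show ?thesis .
  qed
  have "(\<lambda>n. \<bar>t\<bar> ^ 3 * B ^ 3 / 6 * (1 / sqrt (real n)) + t ^ 4 * B ^ 4 / 4 * (1 / real n)) \<longlonglongrightarrow>
      \<bar>t\<bar> ^ 3 * B ^ 3 / 6 * 0 + t ^ 4 * B ^ 4 / 4 * 0"
    by (intro tendsto_intros lim_1_over_n)
       (auto intro!: tendsto_divide_0 filterlim_at_top_imp_at_infinity
          filterlim_compose[OF sqrt_at_top] filterlim_real_sequentially)
  then have "(\<lambda>n. \<phi> n - exp (- (V n * t\<^sup>2 / 2))) \<longlonglongrightarrow> 0"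
    by (intro Lim_null_comparison[OF eventually_mono[OF eventually_gt_at_top[of 0] main]]) auto
  moreover have "(\<lambda>n. complex_of_real (exp (- (V n * t\<^sup>2 / 2)))) \<longlonglongrightarrow> exp (- (v * t\<^sup>2 / 2))"
    using var unfolding V_def by (intro tendsto_intros) auto
  ultimately have "\<phi> \<longlonglongrightarrow> exp (- (v * t\<^sup>2 / 2))"
    using Lim_transform by blast
  then show "(\<lambda>n. char (distr M borel (\<lambda>\<omega>. (\<Sum>j<n. g n (Xs j \<omega>)) / sqrt (real n))) t)
      \<longlonglongrightarrow> char (normal_distribution 0 v) t"
    by (simp add: \<phi>_def[abs_def] char_normal_distribution[OF v])
qed

section \<open>Laplace asymptotics at the frequency cut-off\<close>

text \<open>The expansion at the endpoint only controls \<open>\<phi>w (1 - u)\<close> for small \<open>u\<close>; away from \<open>0\<close> the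
  power \<open>u powr \<alpha>\<close> is bounded below, and boundedness of \<open>\<phi>w\<close> suffices.  The resulting bound on all of
  \<open>(0, 1]\<close> is what makes the dominated convergence argument below possible.\<close>

lemma powr_bound_near_one:
  fixes \<phi>w :: "real \<Rightarrow> real"
  assumes bdd: "bounded (range \<phi>w)" and a: "0 \<le> \<alpha>"
    and edge: "(\<lambda>t. \<phi>w (1 - t) - A * t powr \<alpha>) \<in> o[at_right 0](\<lambda>t. t powr \<alpha>)"
  obtains B where "0 \<le> B" "\<And>u. 0 < u \<Longrightarrow> u \<le> 1 \<Longrightarrow> \<bar>\<phi>w (1 - u)\<bar> \<le> B * u powr \<alpha>"
proof -
  obtain K where K: "\<And>t. \<bar>\<phi>w t\<bar> \<le> K"
    using bdd by (auto simp: bounded_iff)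
  then have K0: "0 \<le> K" by (rule order_trans[OF abs_ge_zero])
  from landau_o.smallD[OF edge, of 1]
  obtain d where d: "0 < d" "\<And>u. 0 < u \<Longrightarrow> u < d \<Longrightarrow> \<bar>\<phi>w (1 - u) - A * u powr \<alpha>\<bar> \<le> u powr \<alpha>"
    by (auto simp: eventually_at_right_field)
  define B where "B = max (\<bar>A\<bar> + 1) (K / d powr \<alpha>)"
  have "\<bar>\<phi>w (1 - u)\<bar> \<le> B * u powr \<alpha>" if u: "0 < u" for u
  proof (cases "u < d")
    case True
    have "\<bar>\<phi>w (1 - u)\<bar> \<le> (\<bar>A\<bar> + 1) * u powr \<alpha>"
      using d(2)[OF u True] abs_mult[of A "u powr \<alpha>"] by (simp add: algebra_simps)
    also have "\<dots> \<le> B * u powr \<alpha>"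
      unfolding B_def by (rule mult_right_mono) auto
    finally show ?thesis .
  next
    case False
    then have "d powr \<alpha> \<le> u powr \<alpha>" using d a by (intro powr_mono2) auto
    then have "K \<le> K / d powr \<alpha> * u powr \<alpha>"
      using K0 d by (simp add: field_simps mult_left_mono)
    also have "\<dots> \<le> B * u powr \<alpha>"
      unfolding B_def by (rule mult_right_mono) auto
    finally show ?thesis using K[of "1 - u"] by simp
  qed
  moreover have "0 \<le> B" by (simp add: B_def)
  ultimately show ?thesis using that by blast
qed

lemma has_bochner_integral_Gamma_scaled:
  fixes a c :: real
  assumes "-1 < a" "0 < c"
  shows "has_bochner_integral lborel (\<lambda>v. indicator {0<..} v * (v powr a * exp (- (c * v))))
           (Gamma (a + 1) / c powr (a + 1))"
proof -
  define F where "F t = indicator {0..} t * t powr a / exp t" for t :: real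
  have [measurable]: "F \<in> borel_measurable borel"
    unfolding F_def[abs_def] by measurable
  have "has_bochner_integral lborel F (Gamma (a + 1))"
  proof (rule has_bochner_integral_nn_integral)
    show "(\<integral>\<^sup>+t. ennreal (F t) \<partial>lborel) = ennreal (Gamma (a + 1))"
      using Gamma_conv_nn_integral_real[of "a + 1"] assms by (simp add: F_def)
  qed (use assms in \<open>auto simp: F_def intro!: Gamma_real_nonneg\<close>)
  then have "has_bochner_integral lborel (\<lambda>v. F (0 + c * v)) (Gamma (a + 1) /\<^sub>R \<bar>c\<bar>)"
    using assms by (subst lborel_has_bochner_integral_real_affine_iff[symmetric]) auto
  then have "has_bochner_integral lborel (\<lambda>v. F (c * v) / c powr a) (Gamma (a + 1) / c / c powr a)"
    using assms by (intro has_bochner_integral_divide_zero) (simp add: divide_inverse mult.commute)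
  moreover have "F (c * v) / c powr a = indicator {0<..} v * (v powr a * exp (- (c * v)))" for v
    using assms by (cases "0 < v")
      (auto simp: F_def indicator_def powr_mult exp_minus field_simps zero_le_mult_iff)
  ultimately show ?thesis
    using assms by (simp add: powr_add mult.commute)
qed

text \<open>The integral \<open>\<integral> cos (t u) exp (\<sigma>\<^sup>2 t\<^sup>2 / 2) \<phi>w (h t) dt\<close> over \<open>0 < t < 1/h\<close> is dominated by the region
  within distance \<open>O(h)\<close> of the right endpoint.  The substitution \<open>t = 1/h - h v\<close> blows this region up
  to scale \<open>1\<close>; the factor \<open>h powr (1 + 2 * \<alpha>) * exp (\<sigma>\<^sup>2 / (2 * h\<^sup>2))\<close> splits off, and the following
  integral remains.\<close>

definition edge_integral :: "(real \<Rightarrow> real) \<Rightarrow> real \<Rightarrow> real \<Rightarrow> real \<Rightarrow> real \<Rightarrow> real" where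
  "edge_integral \<phi>w \<sigma> \<alpha> h u =
     (LBINT v. indicator {0<..<1/h\<^sup>2} v * (cos ((1 / h - h * v) * u) *
        exp (\<sigma>\<^sup>2 * h\<^sup>2 * v\<^sup>2 / 2 - \<sigma>\<^sup>2 * v) * (\<phi>w (1 - h\<^sup>2 * v) / h powr (2 * \<alpha>))))"

lemma edge_integral_measurable[measurable]:
  assumes [measurable]: "\<phi>w \<in> borel_measurable borel"
  shows "edge_integral \<phi>w \<sigma> \<alpha> h \<in> borel_measurable borel"
  unfolding edge_integral_def by measurable

text \<open>On the domain of integration \<open>h\<^sup>2 * v < 1\<close>, so the positive quadratic term in the exponent is at
  most half of the negative linear one.  This gives a dominating function that does not depend on
  \<open>h\<close> or \<open>u\<close>.\<close>

lemma edge_integrand_bound: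
  fixes h v \<sigma> \<alpha> B u :: real
  assumes h: "0 < h" and B: "\<And>u. 0 < u \<Longrightarrow> u \<le> 1 \<Longrightarrow> \<bar>\<phi>w (1 - u)\<bar> \<le> B * u powr \<alpha>" and B0: "0 \<le> B"
  shows "\<bar>indicator {0<..<1/h\<^sup>2} v * (cos ((1 / h - h * v) * u) *
        exp (\<sigma>\<^sup>2 * h\<^sup>2 * v\<^sup>2 / 2 - \<sigma>\<^sup>2 * v) * (\<phi>w (1 - h\<^sup>2 * v) / h powr (2 * \<alpha>)))\<bar>
     \<le> B * (indicator {0<..} v * (v powr \<alpha> * exp (- (\<sigma>\<^sup>2 / 2 * v))))"
proof (cases "0 < v \<and> v < 1 / h\<^sup>2")
  case True
  then have hv: "0 < h\<^sup>2 * v" "h\<^sup>2 * v < 1" and v: "0 < v" using h by (auto simp: field_simps)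
  have "\<sigma>\<^sup>2 * h\<^sup>2 * v\<^sup>2 / 2 = \<sigma>\<^sup>2 / 2 * v * (h\<^sup>2 * v)" by (simp add: power2_eq_square)
  also have "\<dots> \<le> \<sigma>\<^sup>2 / 2 * v * 1" using hv v by (intro mult_left_mono) auto
  finally have e: "exp (\<sigma>\<^sup>2 * h\<^sup>2 * v\<^sup>2 / 2 - \<sigma>\<^sup>2 * v) \<le> exp (- (\<sigma>\<^sup>2 / 2 * v))" by simp
  have "\<bar>\<phi>w (1 - h\<^sup>2 * v)\<bar> \<le> B * (h\<^sup>2 * v) powr \<alpha>" using B hv by simp
  also have "(h\<^sup>2 * v) powr \<alpha> = h powr (2 * \<alpha>) * v powr \<alpha>"
    using h v by (simp add: powr_mult powr_powr flip: powr_numeral)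
  finally have p: "\<bar>\<phi>w (1 - h\<^sup>2 * v)\<bar> / h powr (2 * \<alpha>) \<le> B * v powr \<alpha>"
    using h by (simp add: field_simps)
  have "\<bar>cos ((1 / h - h * v) * u)\<bar> * exp (\<sigma>\<^sup>2 * h\<^sup>2 * v\<^sup>2 / 2 - \<sigma>\<^sup>2 * v) * (\<bar>\<phi>w (1 - h\<^sup>2 * v)\<bar> / h powr (2 * \<alpha>))
     \<le> 1 * exp (- (\<sigma>\<^sup>2 / 2 * v)) * (B * v powr \<alpha>)"
    using e p by (intro mult_mono) auto
  then show ?thesis using True by (simp add: abs_mult mult_ac)
qed (use B0 in \<open>auto simp: indicator_def\<close>)

lemma edge_integral_bounded:
  assumes h: "0 < h" and s: "0 < \<sigma>" and a: "0 \<le> \<alpha>"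
    and B: "\<And>u. 0 < u \<Longrightarrow> u \<le> 1 \<Longrightarrow> \<bar>\<phi>w (1 - u)\<bar> \<le> B * u powr \<alpha>" and B0: "0 \<le> B"
  shows "\<bar>edge_integral \<phi>w \<sigma> \<alpha> h u\<bar> \<le> B * (Gamma (\<alpha> + 1) / (\<sigma>\<^sup>2 / 2) powr (\<alpha> + 1))"
proof -
  have G: "has_bochner_integral lborel (\<lambda>v. B * (indicator {0<..} v * (v powr \<alpha> * exp (- (\<sigma>\<^sup>2 / 2 * v)))))
      (B * (Gamma (\<alpha> + 1) / (\<sigma>\<^sup>2 / 2) powr (\<alpha> + 1)))"
    using s a by (intro has_bochner_integral_mult_right has_bochner_integral_Gamma_scaled) auto
  show ?thesis
    unfolding edge_integral_def has_bochner_integral_integral_eq[OF G, symmetric]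
    by (rule order_trans[OF integral_abs_bound], rule integral_mono')
       (use G edge_integrand_bound[OF h B B0] B0 in \<open>auto simp: has_bochner_integral_iff\<close>)
qed

text \<open>For fixed \<open>v\<close> the amplitude of the integrand tends to \<open>A * v powr \<alpha> * exp (- \<sigma>\<^sup>2 * v)\<close>, while the
  phase \<open>(1/h - h * v) * u\<close> differs from \<open>u/h\<close> only by \<open>h * v * u\<close>.  The oscillation \<open>cos (u/h)\<close> itself has
  no limit, so dominated convergence is applied to the difference of the two integrands.\<close>

lemma edge_integral_asymptotics:
  fixes h :: "nat \<Rightarrow> real"
  assumes [measurable]: "\<phi>w \<in> borel_measurable borel"
    and s: "0 < \<sigma>" and a: "0 \<le> \<alpha>" and bdd: "bounded (range \<phi>w)"
    and edge: "(\<lambda>t. \<phi>w (1 - t) - A * t powr \<alpha>) \<in> o[at_right 0](\<lambda>t. t powr \<alpha>)"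
    and h: "\<And>n. 0 < h n" "h \<longlonglongrightarrow> 0"
  shows "(\<lambda>n. edge_integral \<phi>w \<sigma> \<alpha> (h n) u -
            A * Gamma (\<alpha> + 1) / (\<sigma>\<^sup>2) powr (\<alpha> + 1) * cos (u / h n)) \<longlonglongrightarrow> 0"
proof -
  obtain B where B0: "0 \<le> B" and B: "\<And>u. 0 < u \<Longrightarrow> u \<le> 1 \<Longrightarrow> \<bar>\<phi>w (1 - u)\<bar> \<le> B * u powr \<alpha>"
    using powr_bound_near_one[OF bdd a edge] by metis
  define S where "S n v = indicator {0<..<1/(h n)\<^sup>2} v * (cos ((1 / h n - h n * v) * u) *
        exp (\<sigma>\<^sup>2 * (h n)\<^sup>2 * v\<^sup>2 / 2 - \<sigma>\<^sup>2 * v) * (\<phi>w (1 - (h n)\<^sup>2 * v) / h n powr (2 * \<alpha>)))" for n v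
  define L where "L v = indicator {0<..} v * (v powr \<alpha> * exp (- (\<sigma>\<^sup>2 * v)))" for v
  define D where "D v = indicator {0<..} v * (v powr \<alpha> * exp (- (\<sigma>\<^sup>2 / 2 * v)))" for v
  have [measurable]: "S n \<in> borel_measurable borel" "L \<in> borel_measurable borel" for n
    unfolding S_def L_def by measurable
  have iD: "integrable lborel D"
    unfolding D_def using has_bochner_integral_Gamma_scaled[of \<alpha> "\<sigma>\<^sup>2 / 2"] s a
    by (auto simp: has_bochner_integral_iff)
  have iL: "integrable lborel L" "(LBINT v. L v) = Gamma (\<alpha> + 1) / (\<sigma>\<^sup>2) powr (\<alpha> + 1)"
    unfolding L_def using has_bochner_integral_Gamma_scaled[of \<alpha> "\<sigma>\<^sup>2"] s a
    by (auto simp: has_bochner_integral_iff)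
  have SB: "\<bar>S n v\<bar> \<le> B * D v" for n v
    unfolding S_def D_def by (rule edge_integrand_bound[OF h(1) B B0])
  have iS: "integrable lborel (S n)" for n
    by (rule Bochner_Integration.integrable_bound[OF integrable_mult_right[OF iD, of B]])
       (use SB in \<open>auto intro: order_trans[OF _ abs_ge_self]\<close>)
  have LD: "L v \<le> D v" "0 \<le> L v" for v
    using s by (auto simp: L_def D_def indicator_def intro!: mult_left_mono)
  have ptw: "(\<lambda>n. S n v - A * L v * cos (u / h n)) \<longlonglongrightarrow> 0" for v
  proof (cases "0 < v")
    case True
    \<comment> \<open>The integrand without its oscillating factor.\<close>
    define q where "q n = exp (\<sigma>\<^sup>2 * (h n)\<^sup>2 * v\<^sup>2 / 2 - \<sigma>\<^sup>2 * v) * (\<phi>w (1 - (h n)\<^sup>2 * v) / h n powr (2 * \<alpha>))" for n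
    have hv: "filterlim (\<lambda>n. (h n)\<^sup>2 * v) (at_right 0) sequentially"
    proof (rule tendsto_imp_filterlim_at_right)
      show "(\<lambda>n. (h n)\<^sup>2 * v) \<longlonglongrightarrow> 0"
        using tendsto_mult_right[OF tendsto_power[OF h(2), of 2], of v] by simp
      show "\<forall>\<^sub>F n in sequentially. 0 < (h n)\<^sup>2 * v"
        using True by (intro always_eventually allI mult_pos_pos zero_less_power h(1))
    qed
    have "((\<lambda>t. \<phi>w (1 - t) / t powr \<alpha> - A) \<longlongrightarrow> 0) (at_right 0)"
    proof (rule Lim_transform_eventually[OF smalloD_tendsto[OF edge]])
      show "\<forall>\<^sub>F t in at_right 0. (\<phi>w (1 - t) - A * t powr \<alpha>) / t powr \<alpha> = \<phi>w (1 - t) / t powr \<alpha> - A"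
        by (auto simp: eventually_at_right_field diff_divide_distrib intro!: exI[of _ 1])
    qed
    then have "((\<lambda>t. \<phi>w (1 - t) / t powr \<alpha>) \<longlongrightarrow> A) (at_right 0)"
      by (simp add: LIM_zero_iff)
    from filterlim_compose[OF this hv]
    have "(\<lambda>n. \<phi>w (1 - (h n)\<^sup>2 * v) / ((h n)\<^sup>2 * v) powr \<alpha> * v powr \<alpha>) \<longlonglongrightarrow> A * v powr \<alpha>"
      by (rule tendsto_mult_right)
    moreover have "((h n)\<^sup>2 * v) powr \<alpha> = h n powr (2 * \<alpha>) * v powr \<alpha>" for n
      using h(1)[of n] True by (simp add: powr_mult powr_powr flip: powr_numeral)
    ultimately have p: "(\<lambda>n. \<phi>w (1 - (h n)\<^sup>2 * v) / h n powr (2 * \<alpha>)) \<longlonglongrightarrow> A * v powr \<alpha>"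
      using True by simp
    have e: "(\<lambda>n. exp (\<sigma>\<^sup>2 * (h n)\<^sup>2 * v\<^sup>2 / 2 - \<sigma>\<^sup>2 * v)) \<longlonglongrightarrow> exp (\<sigma>\<^sup>2 * 0\<^sup>2 * v\<^sup>2 / 2 - \<sigma>\<^sup>2 * v)"
      by (intro tendsto_intros h) auto
    have q: "q \<longlonglongrightarrow> A * L v"
      using tendsto_mult[OF e p] True unfolding q_def L_def by (simp add: mult_ac)
    have "\<bar>cos (u / h n - h n * v * u) - cos (u / h n)\<bar> \<le> h n * \<bar>v * u\<bar>" for n
    proof -
      have "cos (u / h n - h n * v * u) - cos (u / h n) =
          2 * (sin ((u / h n - h n * v * u + u / h n) / 2) * sin (h n * v * u / 2))"
        by (simp add: cos_diff_cos)
      also have "\<bar>\<dots>\<bar> \<le> 2 * (1 * \<bar>h n * v * u / 2\<bar>)"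
        unfolding abs_mult[of _ "sin (h n * v * u / 2)"] abs_mult[of 2]
        by (intro mult_mono abs_sin_x_le_abs_x abs_sin_le_one) auto
      also have "\<dots> = h n * \<bar>v * u\<bar>" using h(1)[of n] by (simp add: abs_mult)
      finally show ?thesis .
    qed
    then have "\<forall>\<^sub>F n in sequentially.
        norm (cos ((1 / h n - h n * v) * u) - cos (u / h n)) \<le> h n * \<bar>v * u\<bar>"
      by (simp add: left_diff_distrib)
    moreover have "(\<lambda>n. h n * \<bar>v * u\<bar>) \<longlonglongrightarrow> 0"
      using h(2) by (rule tendsto_mult_left_zero)
    ultimately have c: "(\<lambda>n. cos ((1 / h n - h n * v) * u) - cos (u / h n)) \<longlonglongrightarrow> 0"
      by (rule Lim_null_comparison)
    have "(\<lambda>n. q n * (cos ((1 / h n - h n * v) * u) - cos (u / h n))) \<longlonglongrightarrow> 0"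
      using tendsto_mult[OF q c] by simp
    moreover have "(\<lambda>n. (q n - A * L v) * cos (u / h n)) \<longlonglongrightarrow> 0"
    proof (rule Lim_null_comparison)
      show "\<forall>\<^sub>F n in sequentially. norm ((q n - A * L v) * cos (u / h n)) \<le> \<bar>q n - A * L v\<bar>"
        by (auto simp: abs_mult intro!: always_eventually mult_right_le_one_le)
      show "(\<lambda>n. \<bar>q n - A * L v\<bar>) \<longlonglongrightarrow> 0"
        using tendsto_rabs[OF tendsto_diff[OF q tendsto_const[of "A * L v"]]] by simp
    qed
    ultimately have "(\<lambda>n. q n * (cos ((1 / h n - h n * v) * u) - cos (u / h n)) + (q n - A * L v) * cos (u / h n)) \<longlonglongrightarrow> 0"
      using tendsto_add by fastforce
    moreover have "\<forall>\<^sub>F n in sequentially. q n * (cos ((1 / h n - h n * v) * u) - cos (u / h n)) + (q n - A * L v) * cos (u / h n)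
        = S n v - A * L v * cos (u / h n)"
    proof -
      have "\<forall>\<^sub>F n in sequentially. (h n)\<^sup>2 * v < 1"
        using hv by (auto simp: filterlim_at intro: order_tendstoD(2))
      then show ?thesis
      proof eventually_elim
        case (elim n)
        then have "v < 1 / (h n)\<^sup>2"
          using h(1)[of n] by (simp add: pos_less_divide_eq mult.commute)
        then have "S n v = q n * cos ((1 / h n - h n * v) * u)"
          using True by (simp add: S_def q_def)
        then show ?case by (simp add: right_diff_distrib left_diff_distrib)
      qed
    qed
    ultimately show ?thesis by (rule Lim_transform_eventually)
  qed (simp add: S_def L_def)
  have "(\<lambda>n. LBINT v. S n v - A * L v * cos (u / h n)) \<longlonglongrightarrow> (LBINT v::real. 0)"
  proof (rule integral_dominated_convergence[where w = "\<lambda>v. (B + \<bar>A\<bar>) * D v"])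
    show "integrable lborel (\<lambda>v. (B + \<bar>A\<bar>) * D v)" using iD by simp
    show "AE v in lborel. norm (S n v - A * L v * cos (u / h n)) \<le> (B + \<bar>A\<bar>) * D v" for n
    proof (rule AE_I2)
      fix v
      have "\<bar>A * L v * cos (u / h n)\<bar> \<le> \<bar>A\<bar> * D v * 1"
        unfolding abs_mult using LD[of v] by (intro mult_mono) auto
      then show "norm (S n v - A * L v * cos (u / h n)) \<le> (B + \<bar>A\<bar>) * D v"
        using SB[of n v] by (simp add: algebra_simps)
    qed
  qed (use ptw in auto)
  moreover have "(LBINT v. S n v - A * L v * cos (u / h n)) =
      edge_integral \<phi>w \<sigma> \<alpha> (h n) u - A * Gamma (\<alpha> + 1) / (\<sigma>\<^sup>2) powr (\<alpha> + 1) * cos (u / h n)" for n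
    using iS[of n] iL(1) by (simp add: iL(2) S_def[abs_def] edge_integral_def)
  ultimately show ?thesis by simp
qed

section \<open>Fast oscillations under a law with vanishing characteristic function\<close>

text \<open>The Gaussian noise forces the characteristic function of the observations to decay, whatever the
  law of the signal, atoms included.\<close>

lemma (in prob_space) cmod_char_add_normal_le:
  assumes indep: "indep_var borel Y borel Z"
    and Z: "distributed M lborel Z std_normal_density"
  shows "cmod (char (distr M borel (\<lambda>\<omega>. Y \<omega> + \<sigma> * Z \<omega>)) t) \<le> exp (- (\<sigma>\<^sup>2 * t\<^sup>2 / 2))"
proof -
  have [measurable]: "Y \<in> borel_measurable M" "Z \<in> borel_measurable M"
    using indep by (auto dest: indep_var_rv1 indep_var_rv2)
  have ind: "indep_var borel Y borel (\<lambda>\<omega>. \<sigma> * Z \<omega>)"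
    using indep_var_compose[OF indep, of id borel "\<lambda>z. \<sigma> * z" borel] by (simp add: comp_def)
  interpret Y: real_distribution "distr M borel Y" by simp
  have dZ: "distr M borel Z = std_normal_distribution"
    using distributed_distr_eq_density[OF Z] distr_cong[of M M lborel borel Z Z] by simp
  have "char (distr M borel (\<lambda>\<omega>. \<sigma> * Z \<omega>)) t = char (distr M borel Z) (\<sigma> * t)"
    by (simp add: char_def integral_distr mult_ac)
  then have "cmod (char (distr M borel (\<lambda>\<omega>. \<sigma> * Z \<omega>)) t) = exp (- (\<sigma>\<^sup>2 * t\<^sup>2 / 2))"
    by (simp add: dZ char_std_normal_distribution power_mult_distrib)
  then show ?thesis
    using Y.cmod_char_le_1[of t] by (simp add: char_distr_add[OF ind] norm_mult mult_left_le_one_le)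
qed

text \<open>Up to a factor of modulus \<open>1\<close> the expectation is the real part of the characteristic function.\<close>

lemma (in real_distribution) abs_expectation_cos_le:
  "\<bar>expectation (\<lambda>y. cos (s * (y - x)))\<bar> \<le> cmod (char M s)"
proof -
  have i: "integrable M (\<lambda>y. iexp (s * (y - x)))"
    by (intro integrable_const_bound[of _ 1]) auto
  have "expectation (\<lambda>y. cos (s * (y - x))) = Re (CLINT y|M. iexp (s * (y - x)))"
    by (subst integral_Re[OF i, symmetric]) (simp add: Re_exp)
  also have "(CLINT y|M. iexp (s * (y - x))) = (CLINT y|M. iexp (- (s * x)) * iexp (s * y))"
    by (intro Bochner_Integration.integral_cong refl)
       (simp add: algebra_simps flip: exp_add)
  also have "\<dots> = iexp (- (s * x)) * char M s"
    by (simp add: char_def del: of_real_mult)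
  finally show ?thesis
    using abs_Re_le_cmod[of "iexp (- (s * x)) * char M s"] by (simp add: norm_mult)
qed

text \<open>A Riemann--Lebesgue argument.  When the characteristic function vanishes at infinity,
  \<open>cos ((y - x) / h)\<close> has asymptotic mean \<open>0\<close>, and \<open>cos\<^sup>2 = 1/2 + cos (2 _) / 2\<close> has asymptotic mean \<open>1/2\<close>;
  bounded pointwise perturbations that tend to \<open>0\<close> do not change this.\<close>

lemma (in real_distribution) variance_of_oscillation:
  fixes W :: "nat \<Rightarrow> real \<Rightarrow> real" and h :: "nat \<Rightarrow> real"
  assumes char_0: "((\<lambda>s. char M s) \<longlongrightarrow> 0) at_top"
    and h: "\<And>n. 0 < h n" "h \<longlonglongrightarrow> 0"
    and W[measurable]: "\<And>n. W n \<in> borel_measurable borel"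
    and bound: "\<And>n y. \<bar>W n y\<bar> \<le> B"
    and lim: "\<And>y. (\<lambda>n. W n y - C * cos ((y - x) / h n)) \<longlonglongrightarrow> 0"
  shows "(\<lambda>n. variance (W n)) \<longlonglongrightarrow> C\<^sup>2 / 2"
proof -
  let ?c = "\<lambda>k n y. cos (k / h n * (y - x))"
  have hinf: "filterlim (\<lambda>n. k / h n) at_top sequentially" if "0 < k" for k :: real
  proof -
    have "filterlim (\<lambda>n. inverse (h n)) at_top sequentially"
      using h by (intro filterlim_inverse_at_top) auto
    from filterlim_tendsto_pos_mult_at_top[OF tendsto_const that this] show ?thesis
      by (simp add: divide_inverse)
  qed
  have Ec: "(\<lambda>n. expectation (?c k n)) \<longlonglongrightarrow> 0" if "0 < k" for k
  proof (rule Lim_null_comparison)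
    show "\<forall>\<^sub>F n in sequentially. norm (expectation (?c k n)) \<le> cmod (char M (k / h n))"
      using abs_expectation_cos_le by (intro always_eventually allI) (simp only: real_norm_def)
    show "(\<lambda>n. cmod (char M (k / h n))) \<longlonglongrightarrow> 0"
      using filterlim_compose[OF char_0 hinf[OF that]] by (rule tendsto_norm_zero)
  qed
  have ic: "integrable M (?c k n)" for k n
    by (rule integrable_const_bound[of _ 1]) auto
  have iW: "integrable M (W n)" for n
    by (rule integrable_const_bound[of _ B]) (auto simp: bound)
  have B0: "0 \<le> B" using bound[of 0 0] by simp
  have W2: "(W n y)\<^sup>2 \<le> B\<^sup>2" for n y
    using power_mono[OF bound[of n y], of 2] by simp
  have iW2: "integrable M (\<lambda>y. (W n y)\<^sup>2)" for n
    by (rule integrable_const_bound[of _ "B\<^sup>2"]) (auto simp: W2)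
  have c2: "(?c 1 n y)\<^sup>2 = 1 / 2 + ?c 2 n y / 2" for n y
    using cos_double_cos[of "1 / h n * (y - x)"] by (simp add: diff_divide_distrib)
  have lim': "(\<lambda>n. W n y - C * ?c 1 n y) \<longlonglongrightarrow> 0" for y
    using lim[of y] by simp
  have cb: "\<bar>C * ?c k n y\<bar> \<le> \<bar>C\<bar>" for k n y
    by (auto simp: abs_mult intro: mult_right_le_one_le)
  have "(\<lambda>n. expectation (\<lambda>y. W n y - C * ?c 1 n y)) \<longlonglongrightarrow> expectation (\<lambda>_. 0)"
  proof (rule integral_dominated_convergence[where w = "\<lambda>_. B + \<bar>C\<bar>"])
    show "AE y in M. norm (W n y - C * ?c 1 n y) \<le> B + \<bar>C\<bar>" for n
      by (rule AE_I2, unfold real_norm_def) (rule order_trans[OF abs_triangle_ineq4 add_mono[OF bound cb]])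
  qed (use lim' in auto)
  moreover have "expectation (\<lambda>y. W n y - C * ?c 1 n y) = expectation (W n) - C * expectation (?c 1 n)" for n
    using iW[of n] ic[of 1 n] by simp
  moreover have "(\<lambda>n. C * expectation (?c 1 n)) \<longlonglongrightarrow> 0"
    using Ec[of 1] by (intro tendsto_mult_right_zero) simp
  ultimately have EW: "(\<lambda>n. expectation (W n)) \<longlonglongrightarrow> 0"
    using tendsto_add[of "\<lambda>n. expectation (W n) - C * expectation (?c 1 n)" 0 sequentially "\<lambda>n. C * expectation (?c 1 n)" 0]
    by simp
  have "(\<lambda>n. expectation (\<lambda>y. (W n y)\<^sup>2 - C\<^sup>2 * (?c 1 n y)\<^sup>2)) \<longlonglongrightarrow> expectation (\<lambda>_. 0)"
  proof (rule integral_dominated_convergence[where w = "\<lambda>_. B\<^sup>2 + C\<^sup>2"])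
    show "AE y in M. norm ((W n y)\<^sup>2 - C\<^sup>2 * (?c 1 n y)\<^sup>2) \<le> B\<^sup>2 + C\<^sup>2" for n
    proof (rule AE_I2)
      fix y
      have "C\<^sup>2 * (?c 1 n y)\<^sup>2 \<le> C\<^sup>2 * 1"
        by (intro mult_left_mono) (auto simp: abs_square_le_1)
      then show "norm ((W n y)\<^sup>2 - C\<^sup>2 * (?c 1 n y)\<^sup>2) \<le> B\<^sup>2 + C\<^sup>2"
        using W2[of n y] zero_le_power2[of "W n y"] zero_le_power2[of "C * ?c 1 n y"]
        unfolding power_mult_distrib real_norm_def abs_le_iff by linarith
    qed
    have "(\<lambda>n. (W n y - C * ?c 1 n y) * (W n y + C * ?c 1 n y)) \<longlonglongrightarrow> 0" for y
    proof (rule Lim_null_comparison)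
      show "\<forall>\<^sub>F n in sequentially. norm ((W n y - C * ?c 1 n y) * (W n y + C * ?c 1 n y))
          \<le> \<bar>W n y - C * ?c 1 n y\<bar> * (B + \<bar>C\<bar>)"
        using bound cb by (intro always_eventually allI)
           (auto simp only: real_norm_def abs_mult
             intro!: mult_left_mono order_trans[OF abs_triangle_ineq] add_mono abs_ge_zero)
      show "(\<lambda>n. \<bar>W n y - C * ?c 1 n y\<bar> * (B + \<bar>C\<bar>)) \<longlonglongrightarrow> 0"
        using lim'[of y] by (intro tendsto_mult_left_zero tendsto_rabs_zero)
    qed
    then show "AE y in M. (\<lambda>n. (W n y)\<^sup>2 - C\<^sup>2 * (?c 1 n y)\<^sup>2) \<longlonglongrightarrow> 0"
      by (simp add: algebra_simps power2_eq_square)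
  qed auto
  moreover have "expectation (\<lambda>y. (W n y)\<^sup>2 - C\<^sup>2 * (?c 1 n y)\<^sup>2) =
      expectation (\<lambda>y. (W n y)\<^sup>2) - C\<^sup>2 * (1 / 2 + expectation (?c 2 n) / 2)" for n
    unfolding c2 using iW2[of n] ic[of 2 n] by (simp add: prob_space del: space_eq_univ)
  moreover have "(\<lambda>n. C\<^sup>2 * (1 / 2 + expectation (?c 2 n) / 2)) \<longlonglongrightarrow> C\<^sup>2 * (1 / 2 + 0 / 2)"
    using Ec[of 2] by (intro tendsto_intros) auto
  ultimately have "(\<lambda>n. expectation (\<lambda>y. (W n y)\<^sup>2)) \<longlonglongrightarrow> C\<^sup>2 / 2"
    using tendsto_add[of "\<lambda>n. expectation (\<lambda>y. (W n y)\<^sup>2) - C\<^sup>2 * (1 / 2 + expectation (?c 2 n) / 2)" 0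
        sequentially "\<lambda>n. C\<^sup>2 * (1 / 2 + expectation (?c 2 n) / 2)" "C\<^sup>2 / 2"]
    by simp
  from tendsto_diff[OF this tendsto_power[OF EW, of 2]] show ?thesis
    using iW iW2 by (simp add: variance_eq)
qed

section \<open>The estimator as a kernel average\<close>

text \<open>The estimator is a kernel average of the sample: up to an additive constant that does not depend on
  the sample, it is the mean of \<open>deconv_kernel \<sigma> p \<phi>w h (X\<^sub>j - x)\<close>.\<close>

definition deconv_kernel :: "real \<Rightarrow> real \<Rightarrow> (real \<Rightarrow> real) \<Rightarrow> real \<Rightarrow> real \<Rightarrow> real" where
  "deconv_kernel \<sigma> p \<phi>w h u =
     1 / (2 * pi) * (LBINT t. cos (t * u) * (\<phi>w (h * t) / ((1 - p) * exp (- (\<sigma>\<^sup>2 * t\<^sup>2 / 2)))))"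

lemma integrable_times_compact_weight:
  fixes F :: "real \<Rightarrow> real"
  assumes [measurable]: "\<phi>w \<in> borel_measurable borel" and bdd: "bounded (range \<phi>w)"
    and supp: "\<And>t. t \<notin> {-1..1} \<Longrightarrow> \<phi>w t = 0" and h: "0 < h"
    and F: "continuous_on UNIV F"
  shows "integrable lborel (\<lambda>t. F t * \<phi>w (h * t))"
proof -
  have [measurable]: "F \<in> borel_measurable borel" by (rule borel_measurable_continuous_onI[OF F])
  obtain K where K: "\<And>t. \<bar>\<phi>w t\<bar> \<le> K"
    using bdd by (auto simp: bounded_iff)
  have "set_integrable lborel {-1/h..1/h} F"
    by (rule borel_integrable_atLeastAtMost') (rule continuous_on_subset[OF F], simp)
  then have "integrable lborel (\<lambda>t. K * (indicator {-1/h..1/h} t * F t))"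
    unfolding set_integrable_def by simp
  then show ?thesis
  proof (rule Bochner_Integration.integrable_bound)
    show "AE t in lborel. norm (F t * \<phi>w (h * t)) \<le> norm (K * (indicator {-1/h..1/h} t * F t))"
    proof (rule AE_I2)
      fix t :: real
      show "norm (F t * \<phi>w (h * t)) \<le> norm (K * (indicator {-1/h..1/h} t * F t))"
      proof (cases "t \<in> {-1/h..1/h}")
        case True
        have "\<bar>\<phi>w (h * t)\<bar> \<le> \<bar>K\<bar>" using K[of "h * t"] by linarith
        then have "\<bar>\<phi>w (h * t)\<bar> * \<bar>F t\<bar> \<le> \<bar>K\<bar> * \<bar>F t\<bar>" by (rule mult_right_mono) simp
        then show ?thesis using True by (simp add: abs_mult mult.commute)
      next
        case False
        then have "h * t \<notin> {-1..1}" using h by (auto simp: field_simps)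
        then show ?thesis using supp by simp
      qed
    qed
  qed simp
qed

text \<open>The constant \<open>c\<close> is the contribution of the subtracted term \<open>p * exp (- (\<sigma>\<^sup>2 * t\<^sup>2 / 2))\<close>; it cancels
  when the estimator is centred.  The rest is linear in the empirical characteristic function, and the
  compact support of \<open>\<phi>w\<close> provides the integrability needed to exchange sum and integral.\<close>

lemma deconv_estimator_eq_average:
  fixes Xs :: "nat \<Rightarrow> 'a \<Rightarrow> real"
  assumes [measurable]: "\<phi>w \<in> borel_measurable borel" and bdd: "bounded (range \<phi>w)"
    and supp: "\<And>t. t \<notin> {-1..1} \<Longrightarrow> \<phi>w t = 0" and h: "0 < h" and p: "p < 1"
  obtains c where "\<And>\<omega>. deconv_estimator \<sigma> p \<phi>w Xs n h x \<omega> =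
    1 / real n * (\<Sum>j<n. deconv_kernel \<sigma> p \<phi>w h (Xs j \<omega> - x)) - c"
proof -
  define m where "m t = \<phi>w (h * t) / ((1 - p) * exp (- (\<sigma>\<^sup>2 * t\<^sup>2 / 2)))" for t
  have [measurable]: "m \<in> borel_measurable borel" unfolding m_def[abs_def] by measurable
  have "continuous_on UNIV (\<lambda>t. 1 / ((1 - p) * exp (- (\<sigma>\<^sup>2 * t\<^sup>2 / 2))))"
    using p by (intro continuous_intros) auto
  then have im: "integrable lborel m"
    using integrable_times_compact_weight[of \<phi>w h "\<lambda>t. 1 / ((1 - p) * exp (- (\<sigma>\<^sup>2 * t\<^sup>2 / 2)))"] assms
    by (simp add: m_def[abs_def])
  have iw: "integrable lborel (\<lambda>t. \<phi>w (h * t))"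
    using integrable_times_compact_weight[of \<phi>w h "\<lambda>_. 1"] assms by simp
  have osc: "integrable lborel (\<lambda>t. iexp (t * u) * complex_of_real (G t))"
    if "integrable lborel G" for G u
  proof -
    note borel_measurable_integrable[OF that, measurable]
    show ?thesis
      by (rule Bochner_Integration.integrable_bound[OF that]) (auto simp: norm_mult)
  qed
  have K: "deconv_kernel \<sigma> p \<phi>w h u = 1 / (2 * pi) * Re (CLBINT t. iexp (t * u) * complex_of_real (m t))" for u
    unfolding deconv_kernel_def m_def[symmetric]
    by (subst integral_Re[OF osc[OF im], symmetric]) (simp add: Re_exp)
  have Re_r: "Re (complex_of_real r * z) = r * Re z" for r z by simp
  define P where "P t = p / (1 - p) * \<phi>w (h * t)" for t
  have iP: "integrable lborel P" unfolding P_def[abs_def] using iw by simp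
  define c where "c = 1 / (2 * pi) * Re (CLBINT t. iexp (t * (- x)) * complex_of_real (P t))"
  have "deconv_estimator \<sigma> p \<phi>w Xs n h x \<omega> =
    1 / real n * (\<Sum>j<n. deconv_kernel \<sigma> p \<phi>w h (Xs j \<omega> - x)) - c" for \<omega>
  proof -
    have "iexp (- (t * x)) * ((emp_char Xs n \<omega> t - complex_of_real (p * exp (- (\<sigma>\<^sup>2 * t\<^sup>2 / 2)))) /
            complex_of_real ((1 - p) * exp (- (\<sigma>\<^sup>2 * t\<^sup>2 / 2))) * complex_of_real (\<phi>w (h * t))) =
       complex_of_real (1 / real n) * (\<Sum>j<n. iexp (t * (Xs j \<omega> - x)) * complex_of_real (m t))
       - iexp (t * (- x)) * complex_of_real (P t)" (is "?l t = ?r t") for t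
    proof -
      have e: "iexp (t * (Xs j \<omega> - x)) = iexp (- (t * x)) * iexp (t * Xs j \<omega>)" for j
        by (simp add: algebra_simps flip: exp_add)
      have P: "complex_of_real (p * exp (- (\<sigma>\<^sup>2 * t\<^sup>2 / 2))) * complex_of_real (m t) = complex_of_real (P t)"
        unfolding of_real_mult[symmetric] by (simp add: P_def m_def)
      have "?l t = iexp (- (t * x)) * ((emp_char Xs n \<omega> t - complex_of_real (p * exp (- (\<sigma>\<^sup>2 * t\<^sup>2 / 2)))) * complex_of_real (m t))"
        by (simp add: m_def)
      also have "\<dots> = iexp (- (t * x)) * (emp_char Xs n \<omega> t * complex_of_real (m t)) - iexp (- (t * x)) * complex_of_real (P t)"
        unfolding left_diff_distrib P right_diff_distrib ..
      also have "iexp (- (t * x)) * (emp_char Xs n \<omega> t * complex_of_real (m t)) =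
          complex_of_real (1 / real n) * (\<Sum>j<n. iexp (t * (Xs j \<omega> - x)) * complex_of_real (m t))"
        unfolding emp_char_def e sum_distrib_left sum_distrib_right by (simp add: mult_ac)
      finally show ?thesis by simp
    qed
    then have "deconv_integral \<sigma> p \<phi>w (emp_char Xs n \<omega>) h x =
        complex_of_real (1 / (2 * pi)) * (CLBINT t. ?r t)"
      unfolding deconv_integral_def inverse_fourier_transform_def by (simp only:)
    also have "(CLBINT t. ?r t) =
        complex_of_real (1 / real n) * (\<Sum>j<n. (CLBINT t. iexp (t * (Xs j \<omega> - x)) * complex_of_real (m t)))
       - (CLBINT t. iexp (t * (- x)) * complex_of_real (P t))"
    proof -
      have i: "integrable lborel (\<lambda>t. \<Sum>j<n. iexp (t * (Xs j \<omega> - x)) * complex_of_real (m t))"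
        by (rule Bochner_Integration.integrable_sum) (rule osc[OF im])
      have "(CLBINT t. ?r t) = (CLBINT t. complex_of_real (1 / real n) *
            (\<Sum>j<n. iexp (t * (Xs j \<omega> - x)) * complex_of_real (m t)))
          - (CLBINT t. iexp (t * (- x)) * complex_of_real (P t))"
        by (rule Bochner_Integration.integral_diff[OF integrable_mult_right[OF i] osc[OF iP]])
      also have "(CLBINT t. complex_of_real (1 / real n) *
            (\<Sum>j<n. iexp (t * (Xs j \<omega> - x)) * complex_of_real (m t))) =
          complex_of_real (1 / real n) *
            (\<Sum>j<n. (CLBINT t. iexp (t * (Xs j \<omega> - x)) * complex_of_real (m t)))"
        unfolding integral_mult_right_zero
        by (subst Bochner_Integration.integral_sum) (rule osc[OF im], rule refl)
      finally show ?thesis .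
    qed
    finally show ?thesis
      unfolding deconv_estimator_def K c_def
      by (simp only: Re_r minus_complex.sel Re_sum right_diff_distrib sum_distrib_left mult.left_commute)
  qed
  then show ?thesis using that by blast
qed

text \<open>The integrand is even, so the kernel is twice the integral over the positive half-line; the
  substitution \<open>t = 1/h - h v\<close> then moves the endpoint \<open>t = 1/h\<close> of the support to \<open>v = 0\<close>.\<close>

lemma deconv_kernel_eq_edge_integral:
  assumes [measurable]: "\<phi>w \<in> borel_measurable borel" and bdd: "bounded (range \<phi>w)"
    and sym: "\<And>t. \<phi>w (- t) = \<phi>w t"
    and supp: "\<And>t. t \<notin> {-1..1} \<Longrightarrow> \<phi>w t = 0" and h: "0 < h" and p: "p < 1"
  shows "deconv_kernel \<sigma> p \<phi>w h u =
    h powr (1 + 2 * \<alpha>) * exp (\<sigma>\<^sup>2 / (2 * h\<^sup>2)) / (pi * (1 - p)) * edge_integral \<phi>w \<sigma> \<alpha> h u"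
proof -
  define G where "G t = cos (t * u) * (\<phi>w (h * t) / ((1 - p) * exp (- (\<sigma>\<^sup>2 * t\<^sup>2 / 2))))" for t
  define H where "H t = indicator {0..} t * G t" for t
  have [measurable]: "G \<in> borel_measurable borel" unfolding G_def[abs_def] by measurable
  have "continuous_on UNIV (\<lambda>t. cos (t * u) / ((1 - p) * exp (- (\<sigma>\<^sup>2 * t\<^sup>2 / 2))))"
    using p by (intro continuous_intros) auto
  then have "integrable lborel G"
    using integrable_times_compact_weight[of \<phi>w h "\<lambda>t. cos (t * u) / ((1 - p) * exp (- (\<sigma>\<^sup>2 * t\<^sup>2 / 2)))"] assms
    by (simp add: G_def[abs_def])
  then have "integrable lborel H"
    unfolding H_def[abs_def] using integrable_mult_indicator[of "{0..}" lborel G] by simp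
  then have "has_bochner_integral lborel (\<lambda>t. indicator {0..} t *\<^sub>R G t) (LBINT t. H t)"
    by (simp add: has_bochner_integral_iff H_def[abs_def])
  from has_bochner_integral_even_function[OF this]
  have "(LBINT t. G t) = 2 * (LBINT t. H t)"
    using sym[of "h * t" for t] by (simp add: G_def has_bochner_integral_iff)
  also have "(LBINT t. H t) = h * (LBINT v. H (1 / h + - h * v))"
    using lborel_integral_real_affine[of "- h" H "1 / h"] h by simp
  also have "(LBINT v. H (1 / h + - h * v)) =
     (LBINT v. h powr (2 * \<alpha>) * exp (\<sigma>\<^sup>2 / (2 * h\<^sup>2)) / (1 - p) *
       (indicator {0<..<1/h\<^sup>2} v * (cos ((1 / h - h * v) * u) *
        exp (\<sigma>\<^sup>2 * h\<^sup>2 * v\<^sup>2 / 2 - \<sigma>\<^sup>2 * v) * (\<phi>w (1 - h\<^sup>2 * v) / h powr (2 * \<alpha>)))))"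
    (is "_ = (LBINT v. ?R v)")
    \<comment> \<open>The two integrands may differ at \<open>v = 0\<close> and \<open>v = 1/h\<^sup>2\<close>, where closed and open intervals disagree.\<close>
  proof (rule integral_cong_AE)
    show "AE v in lborel. H (1 / h + - h * v) = ?R v"
      using AE_lborel_singleton[of 0] AE_lborel_singleton[of "1 / h\<^sup>2"]
    proof eventually_elim
      case (elim v)
      have hh: "h * (1 / h + - h * v) = 1 - h\<^sup>2 * v"
        using h by (simp add: field_simps power2_eq_square)
      consider "v < 0" | "0 < v" "v < 1 / h\<^sup>2" | "1 / h\<^sup>2 < v" using elim by linarith
      then show ?case
      proof cases
        case 1
        then have "h\<^sup>2 * v < 0" using h by (simp add: mult_less_0_iff)
        then have "\<phi>w (1 - h\<^sup>2 * v) = 0" by (intro supp) auto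
        then have "G (1 / h + - h * v) = 0" unfolding G_def hh by simp
        then show ?thesis using 1 by (simp add: H_def)
      next
        case 2
        define r where "r = h powr (2 * \<alpha>)"
        have r: "r \<noteq> 0" using h by (simp add: r_def)
        have "\<sigma>\<^sup>2 * (1 / h + - h * v)\<^sup>2 / 2 = \<sigma>\<^sup>2 / (2 * h\<^sup>2) + (\<sigma>\<^sup>2 * h\<^sup>2 * v\<^sup>2 / 2 - \<sigma>\<^sup>2 * v)"
          using h by (simp add: field_simps power2_eq_square)
        then have e: "1 / exp (- (\<sigma>\<^sup>2 * (1 / h + - h * v)\<^sup>2 / 2)) =
            exp (\<sigma>\<^sup>2 / (2 * h\<^sup>2)) * exp (\<sigma>\<^sup>2 * h\<^sup>2 * v\<^sup>2 / 2 - \<sigma>\<^sup>2 * v)"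
          by (simp only: exp_minus exp_add inverse_eq_divide) simp
        have "0 \<le> 1 / h + - h * v"
          using 2 h by (simp add: field_simps power2_eq_square)
        then have "H (1 / h + - h * v) = cos ((1 / h + - h * v) * u) * \<phi>w (1 - h\<^sup>2 * v) / (1 - p) *
            (1 / exp (- (\<sigma>\<^sup>2 * (1 / h + - h * v)\<^sup>2 / 2)))"
          unfolding H_def G_def hh by simp
        also have "\<dots> = ?R v"
          unfolding e r_def[symmetric] using 2 r by (simp add: mult_ac)
        finally show ?thesis .
      next
        case 3
        then have "1 / h + - h * v < 0"
          using h by (simp add: field_simps power2_eq_square)
        then show ?thesis using 3 by (simp add: H_def)
      qed
    qed
  qed (simp_all add: H_def)
  also have "\<dots> = h powr (2 * \<alpha>) * exp (\<sigma>\<^sup>2 / (2 * h\<^sup>2)) / (1 - p) * edge_integral \<phi>w \<sigma> \<alpha> h u"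
    by (simp only: integral_mult_right_zero edge_integral_def)
  finally show ?thesis
    using h by (simp add: deconv_kernel_def G_def powr_add)
qed

section \<open>Asymptotic normality\<close>

theorem theorem2p2:
  fixes M :: "'a measure"
    and U V Z Y X :: "'a \<Rightarrow> real" and Xs :: "nat \<Rightarrow> 'a \<Rightarrow> real"
    and f w \<phi>w :: "real \<Rightarrow> real"
    and \<sigma> p A \<alpha> x :: real and h :: "nat \<Rightarrow> real"
  assumes "prob_space M"
    and "\<sigma> > 0" and "0 \<le> p" and "p < 1"
    and "prob_space.indep_vars M (\<lambda>_. borel) (\<lambda>i. [U, V, Z] ! i) {..<3}"
    and "measure M {\<omega> \<in> space M. U \<omega> = 0} = p"
    and "measure M {\<omega> \<in> space M. U \<omega> = 1} = 1 - p"
    and "\<And>y. f y \<ge> 0" and "distributed M lborel V f"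
    and "distributed M lborel Z std_normal_density"
    and "\<And>\<omega>. Y \<omega> = U \<omega> * V \<omega>"
    and "\<And>\<omega>. X \<omega> = Y \<omega> + \<sigma> * Z \<omega>"
    and "prob_space.indep_vars M (\<lambda>_. borel) Xs UNIV"
    and "\<And>j. distr M borel (Xs j) = distr M borel X"
    and "integrable lborel (fourier_transform f)"
    and "integrable M (\<lambda>\<omega>. (X \<omega>)\<^sup>2)"
    and "\<phi>w \<in> borel_measurable borel"
    and "\<And>y. complex_of_real (w y) = inverse_fourier_transform (\<lambda>t. complex_of_real (\<phi>w t)) y"
    and "bounded (range \<phi>w)"
    and "\<And>t. \<phi>w (- t) = \<phi>w t"
    and "\<And>t. t \<notin> {-1..1} \<Longrightarrow> \<phi>w t = 0"
    and "\<phi>w 0 = 1"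
    and "\<alpha> \<ge> 0"
    and "(\<lambda>t. \<phi>w (1 - t) - A * t powr \<alpha>) \<in> o[at_right 0](\<lambda>t. t powr \<alpha>)"
    and "\<And>n. h n > 0" and "h \<longlonglongrightarrow> 0"
  shows "weak_conv_m
    (\<lambda>n. distr M borel (\<lambda>\<omega>.
       sqrt (real n) / (h n powr (1 + 2 * \<alpha>) * exp (\<sigma>\<^sup>2 / (2 * (h n)\<^sup>2))) *
       (deconv_estimator \<sigma> p \<phi>w Xs n (h n) x \<omega> -
        prob_space.expectation M (deconv_estimator \<sigma> p \<phi>w Xs n (h n) x))))
    (normal_distribution 0
       (A\<^sup>2 / (2 * pi\<^sup>2 * (1 - p)\<^sup>2) * (1 / \<sigma>\<^sup>2) powr (2 + 2 * \<alpha>) * (Gamma (\<alpha> + 1))\<^sup>2))"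
proof -
  interpret prob_space M by fact
  note [measurable] = assms(17)
  have \<sigma>: "0 < \<sigma>" and p: "p < 1" and \<alpha>: "0 \<le> \<alpha>" and h0: "\<And>n. 0 < h n" and h: "h \<longlonglongrightarrow> 0"
    and bdd: "bounded (range \<phi>w)" and sym: "\<And>t. \<phi>w (- t) = \<phi>w t"
    and supp: "\<And>t. t \<notin> {-1..1} \<Longrightarrow> \<phi>w t = 0"
    and edge: "(\<lambda>t. \<phi>w (1 - t) - A * t powr \<alpha>) \<in> o[at_right 0](\<lambda>t. t powr \<alpha>)"
    and Xs: "indep_vars (\<lambda>_. borel) Xs UNIV"
    by fact+
  define \<mu> where "\<mu> = distr M borel X"
  have Xs_distr: "distr M borel (Xs j) = \<mu>" for j
    unfolding \<mu>_def by fact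
  have [measurable]: "Xs j \<in> borel_measurable M" for j
    using Xs by (simp add: indep_vars_def2)
  interpret \<mu>: real_distribution \<mu>
    by (subst Xs_distr[symmetric, of 0]) simp

  \<comment> \<open>The signal \<open>U V\<close> is independent of the noise, so the law \<open>\<mu>\<close> inherits the decay of the noise.\<close>
  have indep: "indep_var borel (\<lambda>\<omega>. U \<omega> * V \<omega>) borel Z"
  proof -
    have "indep_var (PiM {0, 1} (\<lambda>_. borel)) (\<lambda>\<omega>. \<lambda>i\<in>{0, 1}. ([U, V, Z] ! i) \<omega>)
        (PiM {2} (\<lambda>_. borel)) (\<lambda>\<omega>. \<lambda>i\<in>{2}. ([U, V, Z] ! i) \<omega>)"
      by (rule indep_var_restrict[OF assms(5)]) auto
    then have "indep_var borel ((\<lambda>z. z 0 * z 1) \<circ> (\<lambda>\<omega>. \<lambda>i\<in>{0, 1}. ([U, V, Z] ! i) \<omega>))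
        borel ((\<lambda>z. z 2) \<circ> (\<lambda>\<omega>. \<lambda>i\<in>{2}. ([U, V, Z] ! i) \<omega>))"
      by (rule indep_var_compose) (auto intro!: borel_measurable_times measurable_component_singleton)
    then show ?thesis by (simp add: comp_def numeral_2_eq_2)
  qed
  have X_eq: "X = (\<lambda>\<omega>. U \<omega> * V \<omega> + \<sigma> * Z \<omega>)"
    using assms(11,12) by auto
  have char_bound: "cmod (char \<mu> t) \<le> exp (- (\<sigma>\<^sup>2 * t\<^sup>2 / 2))" for t
    unfolding \<mu>_def X_eq by (rule cmod_char_add_normal_le[OF indep]) fact
  have char_0: "((\<lambda>t. char \<mu> t) \<longlongrightarrow> 0) at_top"
  proof (rule Lim_null_comparison)
    show "\<forall>\<^sub>F t in at_top. norm (char \<mu> t) \<le> exp (- (\<sigma>\<^sup>2 * t\<^sup>2 / 2))"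
      using char_bound by simp
    show "((\<lambda>t::real. exp (- (\<sigma>\<^sup>2 * t\<^sup>2 / 2))) \<longlongrightarrow> 0) at_top"
      using \<sigma> by real_asymp
  qed

  \<comment> \<open>\<open>W n\<close> is the kernel after normalisation, up to the factor \<open>1 / (pi * (1 - p))\<close>.\<close>
  define W where "W n y = edge_integral \<phi>w \<sigma> \<alpha> (h n) (y - x)" for n y
  define C where "C = A * Gamma (\<alpha> + 1) / (\<sigma>\<^sup>2) powr (\<alpha> + 1)"
  have W[measurable]: "W n \<in> borel_measurable borel" for n
    unfolding W_def[abs_def] by measurable
  obtain B where W_bound: "\<And>n y. \<bar>W n y\<bar> \<le> B"
  proof -
    obtain B where "0 \<le> B" "\<And>u. 0 < u \<Longrightarrow> u \<le> 1 \<Longrightarrow> \<bar>\<phi>w (1 - u)\<bar> \<le> B * u powr \<alpha>"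
      using powr_bound_near_one[OF bdd \<alpha> edge] by metis
    from edge_integral_bounded[OF h0 \<sigma> \<alpha> this(2,1)] show ?thesis
      by (intro that[of "B * (Gamma (\<alpha> + 1) / (\<sigma>\<^sup>2 / 2) powr (\<alpha> + 1))"]) (simp add: W_def)
  qed
  have W_lim: "(\<lambda>n. W n y - C * cos ((y - x) / h n)) \<longlonglongrightarrow> 0" for y
    unfolding W_def C_def by (rule edge_integral_asymptotics[OF assms(17) \<sigma> \<alpha> bdd edge h0 h])
  have W_int: "integrable \<mu> (W n)" for n
    by (rule \<mu>.integrable_const_bound[of _ B]) (auto simp: W_bound)
  have W_var: "(\<lambda>n. \<mu>.variance (W n)) \<longlonglongrightarrow> C\<^sup>2 / 2"
    by (rule \<mu>.variance_of_oscillation[OF char_0 h0 h W W_bound W_lim])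

  define g where "g n y = (W n y - \<mu>.expectation (W n)) / (pi * (1 - p))" for n y
  have "weak_conv_m (\<lambda>n. distr M borel (\<lambda>\<omega>. (\<Sum>j<n. g n (Xs j \<omega>)) / sqrt (real n)))
    (normal_distribution 0 (C\<^sup>2 / 2 / (pi * (1 - p))\<^sup>2))"
  proof (rule triangular_clt_bounded[OF Xs Xs_distr])
    show "g n \<in> borel_measurable borel" for n
      unfolding g_def[abs_def] by measurable
    have "\<bar>\<mu>.expectation (W n)\<bar> \<le> B" for n
      using \<mu>.integral_le_const[OF W_int, of n B] \<mu>.integral_ge_const[OF W_int, of "- B" n] W_bound
      by (auto simp: abs_le_iff minus_le_iff)
    then have "\<bar>W n y - \<mu>.expectation (W n)\<bar> \<le> B + B" for n y
      using W_bound by (rule order_trans[OF abs_triangle_ineq4 add_mono, rotated])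
    then show "\<bar>g n y\<bar> \<le> (B + B) / (pi * (1 - p))" for n y
      using p by (simp add: g_def abs_mult divide_right_mono)
    show "\<mu>.expectation (g n) = 0" for n
      using W_int[of n] by (simp add: g_def[abs_def] \<mu>.prob_space del: \<mu>.space_eq_univ)
    show "(\<lambda>n. \<mu>.expectation (\<lambda>y. (g n y)\<^sup>2)) \<longlonglongrightarrow> C\<^sup>2 / 2 / (pi * (1 - p))\<^sup>2"
      using tendsto_divide[OF W_var tendsto_const[of "(pi * (1 - p))\<^sup>2"]] p
      by (simp add: g_def power_divide)
  qed
  moreover have "C\<^sup>2 / 2 / (pi * (1 - p))\<^sup>2 =
      A\<^sup>2 / (2 * pi\<^sup>2 * (1 - p)\<^sup>2) * (1 / \<sigma>\<^sup>2) powr (2 + 2 * \<alpha>) * (Gamma (\<alpha> + 1))\<^sup>2"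
  proof -
    have "(1 / \<sigma>\<^sup>2) powr (2 + 2 * \<alpha>) = (1 / (\<sigma>\<^sup>2) powr (\<alpha> + 1))\<^sup>2"
      using \<sigma> by (simp add: powr_divide power_divide power2_eq_square algebra_simps flip: powr_add)
    then show ?thesis by (simp add: C_def power_divide power_mult_distrib mult_ac)
  qed
  moreover have "sqrt (real n) / (h n powr (1 + 2 * \<alpha>) * exp (\<sigma>\<^sup>2 / (2 * (h n)\<^sup>2))) *
       (deconv_estimator \<sigma> p \<phi>w Xs n (h n) x \<omega> - expectation (deconv_estimator \<sigma> p \<phi>w Xs n (h n) x)) =
      (\<Sum>j<n. g n (Xs j \<omega>)) / sqrt (real n)" for n \<omega>
    \<comment> \<open>For the empty sample both sides vanish.\<close>
  proof (cases "n = 0")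
    case False
    define s where "s = h n powr (1 + 2 * \<alpha>) * exp (\<sigma>\<^sup>2 / (2 * (h n)\<^sup>2))"
    have s: "0 < s" using h0[of n] by (simp add: s_def)
    obtain c where c: "\<And>\<omega>. deconv_estimator \<sigma> p \<phi>w Xs n (h n) x \<omega> =
        1 / real n * (\<Sum>j<n. deconv_kernel \<sigma> p \<phi>w (h n) (Xs j \<omega> - x)) - c"
      using deconv_estimator_eq_average[OF assms(17) bdd supp h0 p, where Xs=Xs and n=n and x=x and \<sigma>=\<sigma>]
      by metis
    have kernel: "deconv_kernel \<sigma> p \<phi>w (h n) (y - x) = s / (pi * (1 - p)) * W n y" for y
      unfolding W_def s_def
      by (rule deconv_kernel_eq_edge_integral[OF assms(17) bdd sym supp h0 p])
    have est: "deconv_estimator \<sigma> p \<phi>w Xs n (h n) x =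
        (\<lambda>\<omega>. 1 / real n * (\<Sum>j<n. s / (pi * (1 - p)) * W n (Xs j \<omega>)) - c)"
      by (rule ext) (simp only: c kernel)
    have WX: "integrable M (\<lambda>\<omega>. W n (Xs j \<omega>))" "expectation (\<lambda>\<omega>. W n (Xs j \<omega>)) = \<mu>.expectation (W n)" for j
      using W_int[of n] integrable_distr_eq[of "Xs j" M borel "W n"] integral_distr[of "Xs j" M borel "W n"]
      by (simp_all add: Xs_distr)
    have "expectation (deconv_estimator \<sigma> p \<phi>w Xs n (h n) x) = s / (pi * (1 - p)) * \<mu>.expectation (W n) - c"
      unfolding est using False by (simp add: WX prob_space)
    then have "deconv_estimator \<sigma> p \<phi>w Xs n (h n) x \<omega> - expectation (deconv_estimator \<sigma> p \<phi>w Xs n (h n) x) =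
        1 / real n * (\<Sum>j<n. s / (pi * (1 - p)) * W n (Xs j \<omega>)) - s / (pi * (1 - p)) * \<mu>.expectation (W n)"
      by (simp add: est)
    also have "\<dots> = s / real n * (\<Sum>j<n. g n (Xs j \<omega>))"
    proof -
      define k where "k = pi * (1 - p)"
      have k: "k \<noteq> 0" using p by (simp add: k_def)
      have sum_g: "(\<Sum>j<n. g n (Xs j \<omega>)) = ((\<Sum>j<n. W n (Xs j \<omega>)) - real n * \<mu>.expectation (W n)) / k"
        by (simp add: g_def sum_subtractf flip: sum_divide_distrib k_def)
      show ?thesis
        unfolding sum_g k_def[symmetric] sum_distrib_left[symmetric] using False k by (simp add: field_simps)
    qed
    finally have "sqrt (real n) / s *
       (deconv_estimator \<sigma> p \<phi>w Xs n (h n) x \<omega> - expectation (deconv_estimator \<sigma> p \<phi>w Xs n (h n) x)) =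
       sqrt (real n) / real n * (\<Sum>j<n. g n (Xs j \<omega>))"
      using s by simp
    also have "sqrt (real n) / real n = 1 / sqrt (real n)"
      using False by (simp add: field_simps)
    finally show ?thesis by (simp add: s_def)
  qed simp
  ultimately show ?thesis by simp
qed

end
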